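(* Let $N\ge1$, $m>0$, $\kappa\ge0$, $\nu_1,\dots,\nu_N\in\mathbb R$, and let $(\Theta(t),\dot\Theta(t))$ be a global solution of the inertial Kuramoto model with initial data $(\Theta^0,\dot\Theta^0)=((\theta_i^0)_i,(\omega_i^0)_i)$. For $\nu,\omega,\theta\in\mathbb R$ define, for $i\in[N]$, $$\tilde\nu_i=\nu_i-\nu,\quad\tilde\theta_i^0=\theta_i^0-\theta,\quad\tilde\omega_i^0=\omega_i^0-\omega,$$ $$\tilde\theta_i(t)=\theta_i(t)-\theta-m\omega(1-e^{-t/m})-\nu(t-m+me^{-t/m}),$$ $$\tilde\omega_i(t)=\omega_i(t)-\omega e^{-t/m}-\nu(1-e^{-t/m}),$$ where $\omega_i=\dot\theta_i$. Then: (1) The transformed state $(\tilde\Theta(t),\dot{\tilde\Theta}(t))$ is a global solution of the inertial Kuramoto model with natural frequencies $\tilde\nu_i$ (and the same $m,\kappa$) and initial data $((\tilde\theta_i^0)_i,(\tilde\omega_i^0)_i)$. (2) If $\nu=\nu_c$ and $\omega=\omega_c^0$, then $\Theta(t)$ is a phase-locked state, meaning that $\theta_i(t)-\theta_j(t)$ is constant in $t$ for all $i,j$, if and only if $\tilde\Theta(t)$ is constant. (3) If $\nu=\nu_c$, then $\Theta(t)$ exhibits asymptotic phase-locking if and only if $\tilde\Theta(t)$ converges as $t\to\infty$.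
   Context: $[N]=\{1,\dots,N\}$. The inertial Kuramoto model with inertia $m$, coupling strength $\kappa$, natural frequencies $\nu_i$ and initial data $(\theta_i^0,\omega_i^0)$ is $$m\ddot\theta_i+\dot\theta_i=\nu_i+\frac\kappa N\sum_{j=1}^N\sin(\theta_j-\theta_i),\quad t>0,\qquad(\theta_i,\dot\theta_i)(0)=(\theta_i^0,\omega_i^0),\quad i\in[N],$$ with real-valued unknowns on $[0,\infty)$. $\nu_c=\frac1N\sum_i\nu_i$, $\omega_c^0=\frac1N\sum_i\omega_i^0$. Asymptotic phase-locking means that $\lim_{t\to\infty}(\theta_i(t)-\theta_j(t))$ exists for all $i,j\in[N]$. *)

theory Defs
  imports "HOL-Analysis.Analysis"
begin

text \<open>
  The index set is a finite type \<open>'n\<close>, so \<open>N = CARD('n) \<ge> 1\<close>.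
  A state is a pair \<open>(\<Theta>, \<Omega>)\<close> of curves in \<open>real ^ 'n\<close>, of which only the values at
  times \<open>t \<ge> 0\<close> matter.
\<close>

definition mean :: "real ^ 'n \<Rightarrow> real" where
  "mean x = (\<Sum>i\<in>UNIV. x $ i) / real CARD('n)"

text \<open>
  Classical solutions: \<open>\<Theta>\<close> is continuously differentiable on \<open>[0, \<infinity>)\<close> with derivative
  \<open>\<Omega>\<close> (one-sided at \<open>0\<close>, which gives the initial velocity its meaning), and the second
  derivative is required to exist, and to satisfy the equation, only at times \<open>t > 0\<close>.
\<close>

definition inertial_kuramoto_solution ::
  "real \<Rightarrow> real \<Rightarrow> real ^ 'n \<Rightarrow> real ^ 'n \<Rightarrow> real ^ 'n \<Rightarrow>
    (real \<Rightarrow> real ^ 'n) \<Rightarrow> (real \<Rightarrow> real ^ 'n) \<Rightarrow> bool" where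
  "inertial_kuramoto_solution m \<kappa> V \<Theta>0 \<Omega>0 \<Theta> \<Omega> \<longleftrightarrow>
    (\<forall>t\<ge>0. (\<Theta> has_vector_derivative \<Omega> t) (at t within {0..})) \<and>
    continuous_on {0..} \<Omega> \<and>
    (\<forall>t>0. \<exists>A. (\<Omega> has_vector_derivative A) (at t) \<and>
      (\<forall>i. m * A $ i + \<Omega> t $ i =
        V $ i + \<kappa> / real CARD('n) * (\<Sum>j\<in>UNIV. sin (\<Theta> t $ j - \<Theta> t $ i)))) \<and>
    \<Theta> 0 = \<Theta>0 \<and> \<Omega> 0 = \<Omega>0"

definition phase_locked_state :: "(real \<Rightarrow> real ^ 'n) \<Rightarrow> bool" where
  "phase_locked_state \<Theta> \<longleftrightarrow> (\<forall>i j. (\<lambda>t. \<Theta> t $ i - \<Theta> t $ j) constant_on {0..})"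

definition asymptotic_phase_locking :: "(real \<Rightarrow> real ^ 'n) \<Rightarrow> bool" where
  "asymptotic_phase_locking \<Theta> \<longleftrightarrow>
    (\<forall>i j. \<exists>L. ((\<lambda>t. \<Theta> t $ i - \<Theta> t $ j) \<longlongrightarrow> L) at_top)"

definition shift_vec :: "real \<Rightarrow> real ^ 'n \<Rightarrow> real ^ 'n" where
  "shift_vec c x = (\<chi> i. x $ i - c)"

definition shift_phase ::
  "real \<Rightarrow> real \<Rightarrow> real \<Rightarrow> real \<Rightarrow> (real \<Rightarrow> real ^ 'n) \<Rightarrow> real \<Rightarrow> real ^ 'n" where
  "shift_phase m \<nu> \<omega> \<theta> \<Theta> t =
    (\<chi> i. \<Theta> t $ i - \<theta> - m * \<omega> * (1 - exp (- t / m)) - \<nu> * (t - m + m * exp (- t / m)))"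

definition shift_velocity ::
  "real \<Rightarrow> real \<Rightarrow> real \<Rightarrow> (real \<Rightarrow> real ^ 'n) \<Rightarrow> real \<Rightarrow> real ^ 'n" where
  "shift_velocity m \<nu> \<omega> \<Omega> t =
    (\<chi> i. \<Omega> t $ i - \<omega> * exp (- t / m) - \<nu> * (1 - exp (- t / m)))"

end

theory Submission
  imports Defs
begin

text \<open>
  Subtracting a common curve \<open>c t\<close> from all phases leaves the phase differences, and hence the
  coupling, unchanged. The curve used here is the solution of \<open>m * c'' + c' = \<nu>\<close> with
  \<open>c 0 = \<theta>\<close> and \<open>c' 0 = \<omega>\<close>, so the shifted phases solve the model with frequencies lowered
  by \<open>\<nu>\<close>.

  As phase differences survive the shift, phase-locking of the original state is a property of
  the shifted one, and only the passage from differences to the individual phases remains. Each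
  coordinate of a vector is its mean plus an average of differences of coordinates, so the
  behaviour of the mean phase decides. Because sine is odd, the coupling terms cancel in the
  mean. For \<open>\<nu> = mean V\<close> the mean velocity \<open>w\<close> of the shifted system therefore solves
  \<open>m * w' + w = 0\<close>, so that \<open>w t = w 0 * exp (- t / m)\<close>, and the mean phase is an explicit
  function converging at an exponential rate (lemma \<open>mean_phase_eq\<close>). It is constant if in
  addition \<open>\<omega>\<close> is the initial mean velocity, since then \<open>w 0 = 0\<close>.
\<close>

section \<open>The mean of a vector\<close>

lemma bounded_linear_mean: "bounded_linear (mean :: real ^ 'n \<Rightarrow> real)"
  unfolding mean_def[abs_def]
  by (intro bounded_linear_divide[THEN bounded_linear_compose] bounded_linear_sum
      bounded_linear_vec_nth)

lemma mean_shift_vec: "mean (shift_vec c x) = mean x - c"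
  by (simp add: mean_def shift_vec_def sum_subtractf diff_divide_distrib)

lemma coordinate_eq_mean_plus_differences:
  fixes x :: "real ^ 'n"
  shows "x $ i = mean x + (\<Sum>j\<in>UNIV. x $ i - x $ j) / real CARD('n)"
  by (simp add: mean_def sum_subtractf diff_divide_distrib)

section \<open>The shifted solution\<close>

lemma shift_phase_difference:
  "shift_phase m \<nu> \<omega> \<theta> \<Theta> t $ i - shift_phase m \<nu> \<omega> \<theta> \<Theta> t $ j = \<Theta> t $ i - \<Theta> t $ j"
  by (simp add: shift_phase_def)

lemma phase_locked_state_shift_phase:
  "phase_locked_state (shift_phase m \<nu> \<omega> \<theta> \<Theta>) \<longleftrightarrow> phase_locked_state \<Theta>"
  by (simp add: phase_locked_state_def shift_phase_difference)

lemma asymptotic_phase_locking_shift_phase: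
  "asymptotic_phase_locking (shift_phase m \<nu> \<omega> \<theta> \<Theta>) \<longleftrightarrow> asymptotic_phase_locking \<Theta>"
  by (simp add: asymptotic_phase_locking_def shift_phase_difference)

lemma has_vector_derivative_vec_iff:
  fixes f :: "real \<Rightarrow> real ^ 'n"
  shows "(f has_vector_derivative D) (at t within S) \<longleftrightarrow>
    (\<forall>i. ((\<lambda>t. f t $ i) has_real_derivative D $ i) (at t within S))"
proof -
  have "(f has_vector_derivative D) (at t within S) \<longleftrightarrow>
      (\<forall>b\<in>Basis. ((\<lambda>t. f t \<bullet> b) has_vector_derivative D \<bullet> b) (at t within S))"
    unfolding has_vector_derivative_def
    by (subst has_derivative_componentwise_within) simp
  then show ?thesis
    by (auto simp: Basis_vec_def inner_axis has_real_derivative_iff_has_vector_derivative)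
qed

lemma shifted_solution:
  fixes V \<Theta>0 \<Omega>0 :: "real ^ 'n" and \<Theta> \<Omega> :: "real \<Rightarrow> real ^ 'n"
  assumes "m > 0" and sol: "inertial_kuramoto_solution m \<kappa> V \<Theta>0 \<Omega>0 \<Theta> \<Omega>"
  shows "inertial_kuramoto_solution m \<kappa> (shift_vec \<nu> V) (shift_vec \<theta> \<Theta>0) (shift_vec \<omega> \<Omega>0)
           (shift_phase m \<nu> \<omega> \<theta> \<Theta>) (shift_velocity m \<nu> \<omega> \<Omega>)"
  unfolding inertial_kuramoto_solution_def
proof (intro conjI allI impI)
  fix t :: real assume "t \<ge> 0"
  then have D: "((\<lambda>t. \<Theta> t $ i) has_real_derivative \<Omega> t $ i) (at t within {0..})" for i
    using sol unfolding inertial_kuramoto_solution_def has_vector_derivative_vec_iff by blast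
  show "(shift_phase m \<nu> \<omega> \<theta> \<Theta> has_vector_derivative shift_velocity m \<nu> \<omega> \<Omega> t)
      (at t within {0..})"
    unfolding has_vector_derivative_vec_iff shift_phase_def shift_velocity_def vec_lambda_beta
    using \<open>m > 0\<close> by (auto intro!: derivative_eq_intros D)
next
  show "continuous_on {0..} (shift_velocity m \<nu> \<omega> \<Omega>)"
    unfolding shift_velocity_def[abs_def]
  proof (intro continuous_intros)
    show "continuous_on {0..} \<Omega>"
      using sol by (simp add: inertial_kuramoto_solution_def)
  qed (use \<open>m > 0\<close> in auto)
next
  fix t :: real assume "t > 0"
  then obtain A where
    A: "((\<lambda>t. \<Omega> t $ i) has_real_derivative A $ i) (at t)" and
    eq: "m * A $ i + \<Omega> t $ i =
        V $ i + \<kappa> / real CARD('n) * (\<Sum>j\<in>UNIV. sin (\<Theta> t $ j - \<Theta> t $ i))" for i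
    using sol unfolding inertial_kuramoto_solution_def has_vector_derivative_vec_iff by meson
  \<comment> \<open>the scalar is the second derivative, at time \<open>t\<close>, of the common curve that is subtracted\<close>
  define B :: "real ^ 'n" where "B = shift_vec ((\<nu> - \<omega>) / m * exp (- t / m)) A"
  have "(shift_velocity m \<nu> \<omega> \<Omega> has_vector_derivative B) (at t)"
    unfolding has_vector_derivative_vec_iff B_def shift_vec_def shift_velocity_def vec_lambda_beta
    using \<open>m > 0\<close>
    by (auto intro!: derivative_eq_intros A simp: field_simps)
  moreover have "m * B $ i + shift_velocity m \<nu> \<omega> \<Omega> t $ i = shift_vec \<nu> V $ i +
      \<kappa> / real CARD('n) * (\<Sum>j\<in>UNIV. sin (shift_phase m \<nu> \<omega> \<theta> \<Theta> t $ j
        - shift_phase m \<nu> \<omega> \<theta> \<Theta> t $ i))" for i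
  proof -
    have "m * B $ i = m * A $ i - (\<nu> - \<omega>) * exp (- t / m)"
      using \<open>m > 0\<close> by (simp add: B_def shift_vec_def right_diff_distrib)
    then show ?thesis
      unfolding shift_phase_difference using eq[of i]
      by (simp add: shift_vec_def shift_velocity_def algebra_simps)
  qed
  ultimately show "\<exists>B. (shift_velocity m \<nu> \<omega> \<Omega> has_vector_derivative B) (at t) \<and>
      (\<forall>i. m * B $ i + shift_velocity m \<nu> \<omega> \<Omega> t $ i = shift_vec \<nu> V $ i +
        \<kappa> / real CARD('n) * (\<Sum>j\<in>UNIV. sin (shift_phase m \<nu> \<omega> \<theta> \<Theta> t $ j
          - shift_phase m \<nu> \<omega> \<theta> \<Theta> t $ i)))"
    by blast
next
  show "shift_phase m \<nu> \<omega> \<theta> \<Theta> 0 = shift_vec \<theta> \<Theta>0"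
    "shift_velocity m \<nu> \<omega> \<Omega> 0 = shift_vec \<omega> \<Omega>0"
    using sol unfolding inertial_kuramoto_solution_def
    by (auto simp: vec_eq_iff shift_phase_def shift_velocity_def shift_vec_def)
qed

section \<open>The mean phase of a solution with zero mean frequency\<close>

text \<open>Transposing the summation indices turns the sum into its own negative.\<close>

lemma sum_coupling_eq_zero:
  fixes x :: "real ^ 'n"
  shows "(\<Sum>i\<in>UNIV. \<Sum>j\<in>UNIV. sin (x $ j - x $ i)) = 0"
proof -
  have "(\<Sum>i\<in>UNIV. \<Sum>j\<in>UNIV. sin (x $ j - x $ i))
      = (\<Sum>i\<in>UNIV. \<Sum>j\<in>UNIV. sin (x $ i - x $ j))"
    by (rule sum.swap)
  also have "\<dots> = (\<Sum>i\<in>UNIV. \<Sum>j\<in>UNIV. - sin (x $ j - x $ i))"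
    by (simp flip: sin_minus)
  also have "\<dots> = - (\<Sum>i\<in>UNIV. \<Sum>j\<in>UNIV. sin (x $ j - x $ i))"
    by (simp add: sum_negf)
  finally show ?thesis by simp
qed

text \<open>
  The coupling drops out of the mean, so the mean velocity solves a linear equation of first
  order; \<open>exp (t / m)\<close> is its integrating factor.
\<close>

lemma mean_velocity_eq:
  fixes V \<Theta>0 \<Omega>0 :: "real ^ 'n" and \<Theta> \<Omega> :: "real \<Rightarrow> real ^ 'n"
  assumes "m > 0" and "mean V = 0" and sol: "inertial_kuramoto_solution m \<kappa> V \<Theta>0 \<Omega>0 \<Theta> \<Omega>"
    and "t \<ge> 0"
  shows "mean (\<Omega> t) = mean \<Omega>0 * exp (- t / m)"
proof (cases "t = 0")
  case True
  then show ?thesis using sol by (simp add: inertial_kuramoto_solution_def)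
next
  case False
  let ?g = "\<lambda>s. mean (\<Omega> s) * exp (s / m)"
  have "(?g has_real_derivative 0) (at s)" if "s > 0" for s
  proof -
    obtain A where A: "(\<Omega> has_vector_derivative A) (at s)" and
      eq: "m * A $ i + \<Omega> s $ i =
        V $ i + \<kappa> / real CARD('n) * (\<Sum>j\<in>UNIV. sin (\<Theta> s $ j - \<Theta> s $ i))" for i
      using sol \<open>s > 0\<close> unfolding inertial_kuramoto_solution_def by meson
    have "m * (\<Sum>i\<in>UNIV. A $ i) + (\<Sum>i\<in>UNIV. \<Omega> s $ i) = (\<Sum>i\<in>UNIV. m * A $ i + \<Omega> s $ i)"
      by (simp add: sum.distrib sum_distrib_left)
    also have "\<dots> = (\<Sum>i\<in>UNIV. V $ i) +
        \<kappa> / real CARD('n) * (\<Sum>i\<in>UNIV. \<Sum>j\<in>UNIV. sin (\<Theta> s $ j - \<Theta> s $ i))"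
      unfolding eq by (simp only: sum.distrib sum_distrib_left)
    also have "\<dots> = 0"
      using \<open>mean V = 0\<close> by (simp add: sum_coupling_eq_zero mean_def)
    finally have "mean A = - mean (\<Omega> s) / m"
      using \<open>m > 0\<close> by (simp add: mean_def field_simps)
    moreover have "((\<lambda>s. mean (\<Omega> s)) has_real_derivative mean A) (at s)"
      using bounded_linear.has_vector_derivative[OF bounded_linear_mean A]
      by (simp add: has_real_derivative_iff_has_vector_derivative)
    ultimately show ?thesis
      using \<open>m > 0\<close> by (auto intro!: derivative_eq_intros)
  qed
  moreover have "continuous_on {0..t} ?g"
  proof (intro continuous_intros bounded_linear.continuous_on[OF bounded_linear_mean])
    show "continuous_on {0..t} \<Omega>"
      using sol unfolding inertial_kuramoto_solution_def
      by (auto elim: continuous_on_subset)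
  qed (use \<open>m > 0\<close> in auto)
  ultimately have "?g t = ?g 0"
    using False \<open>t \<ge> 0\<close> by (intro DERIV_isconst_end) auto
  then show ?thesis
    using sol by (simp add: inertial_kuramoto_solution_def exp_minus field_simps)
qed

lemma mean_phase_eq:
  fixes V \<Theta>0 \<Omega>0 :: "real ^ 'n" and \<Theta> \<Omega> :: "real \<Rightarrow> real ^ 'n"
  assumes "m > 0" and "mean V = 0" and sol: "inertial_kuramoto_solution m \<kappa> V \<Theta>0 \<Omega>0 \<Theta> \<Omega>"
    and "t \<ge> 0"
  shows "mean (\<Theta> t) = mean \<Theta>0 + m * mean \<Omega>0 * (1 - exp (- t / m))"
proof -
  \<comment> \<open>a conserved quantity: the exponential term is minus a primitive of the mean velocity\<close>
  let ?h = "\<lambda>s. mean (\<Theta> s) + m * mean \<Omega>0 * exp (- s / m)"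
  have "(?h has_real_derivative 0) (at s within {0..})" if "s \<in> {0..}" for s
  proof -
    have "(\<Theta> has_vector_derivative \<Omega> s) (at s within {0..})"
      using sol that by (auto simp: inertial_kuramoto_solution_def)
    from bounded_linear.has_vector_derivative[OF bounded_linear_mean this]
    have "((\<lambda>s. mean (\<Theta> s)) has_real_derivative mean \<Omega>0 * exp (- s / m)) (at s within {0..})"
      using mean_velocity_eq[OF assms(1-3)] that
      by (simp add: has_real_derivative_iff_has_vector_derivative)
    then show ?thesis
      using \<open>m > 0\<close> by (auto intro!: derivative_eq_intros)
  qed
  then obtain c where "\<And>s. s \<ge> 0 \<Longrightarrow> ?h s = c"
    using has_field_derivative_zero_constant[of "{0..}" ?h] by auto
  from this[OF \<open>t \<ge> 0\<close>] this[OF order_refl] have "?h t = ?h 0"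
    by (rule trans[OF _ sym])
  then show ?thesis
    using sol by (simp add: inertial_kuramoto_solution_def algebra_simps)
qed

section \<open>From phase differences to phases\<close>

text \<open>
  Phase differences determine a state only up to a curve common to all coordinates. Controlling
  the mean removes this freedom, both for constancy and for convergence.
\<close>

lemma constant_on_iff_phase_locked_state:
  fixes X :: "real \<Rightarrow> real ^ 'n"
  assumes mean: "(\<lambda>t. mean (X t)) constant_on {0..}"
  shows "X constant_on {0..} \<longleftrightarrow> phase_locked_state X"
proof
  assume "X constant_on {0..}"
  then show "phase_locked_state X"
    unfolding phase_locked_state_def constant_on_def by auto
next
  assume "phase_locked_state X"
  then have diff: "X t $ i - X t $ j = X 0 $ i - X 0 $ j" if "t \<in> {0..}" for i j t
  proof -
    obtain c where "\<forall>s\<in>{0..}. X s $ i - X s $ j = c"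
      using \<open>phase_locked_state X\<close> unfolding phase_locked_state_def constant_on_def by blast
    then show ?thesis using that by simp
  qed
  have "X t = X 0" if "t \<in> {0..}" for t
  proof -
    have "mean (X t) = mean (X 0)"
      using mean that unfolding constant_on_def by auto
    then have "mean (X t) + (\<Sum>j\<in>UNIV. X t $ i - X t $ j) / real CARD('n)
        = mean (X 0) + (\<Sum>j\<in>UNIV. X 0 $ i - X 0 $ j) / real CARD('n)" for i
      by (simp only: diff[OF that])
    then have "X t $ i = X 0 $ i" for i
      by (simp only: coordinate_eq_mean_plus_differences[symmetric])
    then show ?thesis
      unfolding vec_eq_iff ..
  qed
  then show "X constant_on {0..}"
    unfolding constant_on_def by blast
qed

lemma convergent_iff_asymptotic_phase_locking:
  fixes X :: "real \<Rightarrow> real ^ 'n"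
  assumes mean: "((\<lambda>t. mean (X t)) \<longlongrightarrow> c) at_top"
  shows "(\<exists>L. (X \<longlongrightarrow> L) at_top) \<longleftrightarrow> asymptotic_phase_locking X"
proof
  assume "\<exists>L. (X \<longlongrightarrow> L) at_top"
  then obtain L where "(X \<longlongrightarrow> L) at_top" ..
  then have "((\<lambda>t. X t $ i - X t $ j) \<longlongrightarrow> L $ i - L $ j) at_top" for i j
    by (intro tendsto_intros)
  then show "asymptotic_phase_locking X"
    unfolding asymptotic_phase_locking_def by blast
next
  assume "asymptotic_phase_locking X"
  then obtain L where L: "((\<lambda>t. X t $ i - X t $ j) \<longlongrightarrow> L i j) at_top" for i j
    unfolding asymptotic_phase_locking_def by metis
  have "((\<lambda>t. mean (X t) + (\<Sum>j\<in>UNIV. X t $ i - X t $ j) / real CARD('n))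
      \<longlongrightarrow> c + (\<Sum>j\<in>UNIV. L i j) / real CARD('n)) at_top" for i
    by (intro tendsto_add mean tendsto_divide tendsto_sum L tendsto_const) simp
  then have "(X \<longlongrightarrow> (\<chi> i. c + (\<Sum>j\<in>UNIV. L i j) / real CARD('n))) at_top"
    by (intro vec_tendstoI)
      (simp only: coordinate_eq_mean_plus_differences[symmetric] vec_lambda_beta)
  then show "\<exists>L. (X \<longlongrightarrow> L) at_top" ..
qed

theorem proposition2p1:
  fixes m \<kappa> \<nu> \<omega> \<theta> :: real
    and V \<Theta>0 \<Omega>0 :: "real ^ 'n"
    and \<Theta> \<Omega> :: "real \<Rightarrow> real ^ 'n"
  assumes "m > 0" and "\<kappa> \<ge> 0"
    and "inertial_kuramoto_solution m \<kappa> V \<Theta>0 \<Omega>0 \<Theta> \<Omega>"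
  shows "inertial_kuramoto_solution m \<kappa> (shift_vec \<nu> V) (shift_vec \<theta> \<Theta>0) (shift_vec \<omega> \<Omega>0)
           (shift_phase m \<nu> \<omega> \<theta> \<Theta>) (shift_velocity m \<nu> \<omega> \<Omega>) \<and>
         (\<nu> = mean V \<and> \<omega> = mean \<Omega>0 \<longrightarrow>
           (phase_locked_state \<Theta> \<longleftrightarrow> shift_phase m \<nu> \<omega> \<theta> \<Theta> constant_on {0..})) \<and>
         (\<nu> = mean V \<longrightarrow>
           (asymptotic_phase_locking \<Theta> \<longleftrightarrow>
             (\<exists>L. (shift_phase m \<nu> \<omega> \<theta> \<Theta> \<longlongrightarrow> L) at_top)))"
proof (intro conjI impI)
  let ?X = "shift_phase m \<nu> \<omega> \<theta> \<Theta>"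
  show shifted: "inertial_kuramoto_solution m \<kappa> (shift_vec \<nu> V) (shift_vec \<theta> \<Theta>0)
      (shift_vec \<omega> \<Omega>0) ?X (shift_velocity m \<nu> \<omega> \<Omega>)"
    using assms(1,3) by (rule shifted_solution)
  have mean_X: "mean (?X t) = mean (shift_vec \<theta> \<Theta>0)
      + m * mean (shift_vec \<omega> \<Omega>0) * (1 - exp (- t / m))" if "\<nu> = mean V" "t \<ge> 0" for t
    by (rule mean_phase_eq[OF \<open>m > 0\<close> _ shifted \<open>t \<ge> 0\<close>]) (simp add: mean_shift_vec that)
  {
    assume centred: "\<nu> = mean V \<and> \<omega> = mean \<Omega>0"
    have "(\<lambda>t. mean (?X t)) constant_on {0..}"
      unfolding constant_on_def using mean_X centred by (auto simp: mean_shift_vec)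
    from constant_on_iff_phase_locked_state[OF this]
    show "phase_locked_state \<Theta> \<longleftrightarrow> ?X constant_on {0..}"
      by (simp add: phase_locked_state_shift_phase)
  }
  {
    assume centred: "\<nu> = mean V"
    have "filterlim (\<lambda>t. inverse m * t) at_top at_top"
      using \<open>m > 0\<close>
      by (intro filterlim_tendsto_pos_mult_at_top[OF tendsto_const _ filterlim_ident]) simp
    then have "filterlim (\<lambda>t. - t / m) at_bot at_top"
      by (simp add: filterlim_uminus_at_bot divide_inverse mult.commute)
    then have "((\<lambda>t. exp (- t / m)) \<longlongrightarrow> 0) at_top"
      by (rule filterlim_compose[OF exp_at_bot])
    then have "((\<lambda>t. mean (shift_vec \<theta> \<Theta>0) + m * mean (shift_vec \<omega> \<Omega>0) * (1 - exp (- t / m)))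
        \<longlongrightarrow> mean (shift_vec \<theta> \<Theta>0) + m * mean (shift_vec \<omega> \<Omega>0) * (1 - 0)) at_top"
      by (intro tendsto_intros)
    moreover have "\<forall>\<^sub>F t in at_top. mean (shift_vec \<theta> \<Theta>0)
        + m * mean (shift_vec \<omega> \<Omega>0) * (1 - exp (- t / m)) = mean (?X t)"
      using eventually_ge_at_top[of 0] by eventually_elim (simp only: mean_X[OF centred])
    ultimately have "((\<lambda>t. mean (?X t))
        \<longlongrightarrow> mean (shift_vec \<theta> \<Theta>0) + m * mean (shift_vec \<omega> \<Omega>0) * (1 - 0)) at_top"
      by (rule Lim_transform_eventually)
    from convergent_iff_asymptotic_phase_locking[OF this]
    show "asymptotic_phase_locking \<Theta> \<longleftrightarrow> (\<exists>L. (?X \<longlongrightarrow> L) at_top)"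
      by (simp add: asymptotic_phase_locking_shift_phase)
  }
qed

end
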